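(* Let $G$ be a digraph on $V=[n]$. Suppose there is a sequence of digraphs $G\subseteq G_1\subseteq\cdots\subseteq G_k=K_n^\circ$ on $V$, where $K_n^\circ$ is the complete digraph on $[n]$ with all loops (arc set $[n]\times[n]$), such that $G_1$ is obtained from $G_0:=G$ and each $G_{t+1}$ is obtained from $G_t$ by adding arcs each of which is admissible for $G_t$ in the following sense: an arc $(j,k)$ is admissible for $G_t$ if there is $i\in V$ with $N^+_G[i]\cap(V\setminus N^+_{G_t}[j])=\{k\}$ and $N^-_G[j]\cap(V\setminus N^-_{G_t}[i])=\emptyset$; an arc $(m,i)$ is admissible for $G_t$ if there is $j\in V$ with $N^+_G[i]\cap(V\setminus N^+_{G_t}[j])=\emptyset$ and $N^-_G[j]\cap(V\setminus N^-_{G_t}[i])=\{m\}$. Then $G$ requires the nSSP.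
   Context: A digraph $G$ has vertex set $[n]$ and arc set $E(G)\subseteq[n]\times[n]$ (arcs $(v,v)$ are loops); $G\subseteq H$ means $E(G)\subseteq E(H)$. $N^+_G[v]=\{u:(v,u)\in E(G)\}$ and $N^-_G[v]=\{w:(w,v)\in E(G)\}$. $\mathcal M(G)$ is the set of real $n\times n$ matrices $A=(a_{ij})$ with $a_{ij}\ne0$ iff $(i,j)\in E(G)$. A real matrix $A$ has the nSSP if the only real $X$ with $A\circ X=O$ (entrywise product) and $AX^\top-X^\top A=O$ is $X=O$; $G$ requires the nSSP if every $A\in\mathcal M(G)$ has the nSSP. *)

theory Defs
  imports "HOL-Analysis.Analysis"
begin

(* A digraph on the vertex set [n] is its arc set; the finite type 'n plays the role of [n].
   Loops are allowed. *)
type_synonym 'n digraph = "('n \<times> 'n) set"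

definition out_nbhd :: "'n digraph \<Rightarrow> 'n \<Rightarrow> 'n set" where
  "out_nbhd G v = {u. (v, u) \<in> G}"

definition in_nbhd :: "'n digraph \<Rightarrow> 'n \<Rightarrow> 'n set" where
  "in_nbhd G v = {w. (w, v) \<in> G}"

definition complete_digraph :: "'n digraph" where
  "complete_digraph = UNIV \<times> UNIV"

definition matrices_of :: "'n::finite digraph \<Rightarrow> (real^'n^'n) set" where
  "matrices_of G = {A. \<forall>i j. A $ i $ j \<noteq> 0 \<longleftrightarrow> (i, j) \<in> G}"

definition entrywise_prod :: "real^'n^'m \<Rightarrow> real^'n^'m \<Rightarrow> real^'n^'m" where
  "entrywise_prod A B = (\<chi> i j. A $ i $ j * B $ i $ j)"

definition nSSP :: "real^'n^'n \<Rightarrow> bool" where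
  "nSSP A \<longleftrightarrow>
     (\<forall>X :: real^'n^'n. entrywise_prod A X = 0 \<and> A ** transpose X - transpose X ** A = 0
        \<longrightarrow> X = 0)"

definition requires_nSSP :: "'n::finite digraph \<Rightarrow> bool" where
  "requires_nSSP G \<longleftrightarrow> (\<forall>A \<in> matrices_of G. nSSP A)"

(* G is the original digraph and H the current one G_t. The two disjuncts are the two kinds of
   admissible arc: (j, k) = (fst a, snd a) with a witness i, and (m, i) = (fst a, snd a) with a
   witness j. *)
definition admissible :: "'n digraph \<Rightarrow> 'n digraph \<Rightarrow> 'n \<times> 'n \<Rightarrow> bool" where
  "admissible G H a \<longleftrightarrow>
     (\<exists>i j k. a = (j, k) \<and>
        out_nbhd G i \<inter> (UNIV - out_nbhd H j) = {k} \<and>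
        in_nbhd G j \<inter> (UNIV - in_nbhd H i) = {}) \<or>
     (\<exists>i j m. a = (m, i) \<and>
        out_nbhd G i \<inter> (UNIV - out_nbhd H j) = {} \<and>
        in_nbhd G j \<inter> (UNIV - in_nbhd H i) = {m})"

end

theory Submission
  imports Defs
begin

text \<open>
  A nonzero entry of \<open>X\<close> can only sit on a non-arc of the current digraph \<open>G\<^sub>t\<close>, and a nonzero
  entry of \<open>A\<close> only on an arc of \<open>G\<close>. Hence the \<open>(i, j)\<close> entry of \<open>A X\<^sup>T = X\<^sup>T A\<close> equates a sum over
  \<open>N\<^sup>+\<^sub>G[i] \<inter> (V \<setminus> N\<^sup>+[j])\<close> with a sum over \<open>N\<^sup>-\<^sub>G[j] \<inter> (V \<setminus> N\<^sup>-[i])\<close>. Admissibility leaves exactly one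
  term in total, so the entry of \<open>X\<close> at the new arc vanishes.
\<close>

lemma commutator_transpose_entry:
  fixes A X :: "real^'n^'n"
  assumes "A ** transpose X - transpose X ** A = 0"
  shows "(\<Sum>l\<in>UNIV. A $ i $ l * X $ j $ l) = (\<Sum>l\<in>UNIV. X $ l $ i * A $ l $ j)"
proof -
  have "(A ** transpose X) $ i $ j = (transpose X ** A) $ i $ j"
    using assms by simp
  then show ?thesis
    by (simp add: matrix_matrix_mult_def transpose_def)
qed

text \<open>Serves as the induction step along the chain: zeros of \<open>X\<close> are given on the
  current \<open>H\<close>, while the support of \<open>A\<close> stays fixed by
  \<open>G\<close>.\<close>

lemma admissible_entry_eq_0:
  fixes A X :: "real^'n^'n"
  assumes A: "A \<in> matrices_of G"
    and comm: "A ** transpose X - transpose X ** A = 0"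
    and X: "\<And>u v. (u, v) \<in> H \<Longrightarrow> X $ u $ v = 0"
    and adm: "admissible G H a"
  shows "X $ fst a $ snd a = 0"
proof -
  have nz: "A $ u $ v \<noteq> 0 \<longleftrightarrow> (u, v) \<in> G" for u v
    using A by (simp add: matrices_of_def)
  have entry: "(\<Sum>l\<in>out_nbhd G i \<inter> (UNIV - out_nbhd H j). A $ i $ l * X $ j $ l)
      = (\<Sum>l\<in>in_nbhd G j \<inter> (UNIV - in_nbhd H i). X $ l $ i * A $ l $ j)" for i j
  proof -
    have "(\<Sum>l\<in>UNIV. A $ i $ l * X $ j $ l)
        = (\<Sum>l\<in>out_nbhd G i \<inter> (UNIV - out_nbhd H j). A $ i $ l * X $ j $ l)"
      by (rule sum.mono_neutral_right) (use nz X in \<open>auto simp: out_nbhd_def\<close>)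
    moreover have "(\<Sum>l\<in>UNIV. X $ l $ i * A $ l $ j)
        = (\<Sum>l\<in>in_nbhd G j \<inter> (UNIV - in_nbhd H i). X $ l $ i * A $ l $ j)"
      by (rule sum.mono_neutral_right) (use nz X in \<open>auto simp: in_nbhd_def\<close>)
    ultimately show ?thesis
      using commutator_transpose_entry[OF comm] by simp
  qed
  from adm consider
    (out) i j k where "a = (j, k)" "out_nbhd G i \<inter> (UNIV - out_nbhd H j) = {k}"
      "in_nbhd G j \<inter> (UNIV - in_nbhd H i) = {}"
  | (into) i j m where "a = (m, i)" "out_nbhd G i \<inter> (UNIV - out_nbhd H j) = {}"
      "in_nbhd G j \<inter> (UNIV - in_nbhd H i) = {m}"
    unfolding admissible_def by blast
  then show ?thesis
  proof cases
    case out
    then have "A $ i $ k * X $ j $ k = 0"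
      using entry[of i j] by simp
    \<comment> \<open>Membership in a neighbourhood in \<open>G\<close> makes the coefficient
      \<open>A $ i $ k\<close> nonzero, so it cancels.\<close>
    moreover have "k \<in> out_nbhd G i"
      using out by blast
    ultimately show ?thesis
      using nz[of i k] out(1) by (simp add: out_nbhd_def)
  next
    case into
    then have "X $ m $ i * A $ m $ j = 0"
      using entry[of i j] by simp
    moreover have "m \<in> in_nbhd G j"
      using into by blast
    ultimately show ?thesis
      using nz[of m j] into(1) by (simp add: in_nbhd_def)
  qed
qed

theorem theorem3p3:
  fixes G :: "'n::finite digraph"
    and Gs :: "nat \<Rightarrow> 'n digraph"
    and k :: nat
  assumes "Gs 0 = G"
    and "Gs k = complete_digraph"
    and "\<And>t. t < k \<Longrightarrow> Gs t \<subseteq> Gs (Suc t)"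
    and "\<And>t a. t < k \<Longrightarrow> a \<in> Gs (Suc t) - Gs t \<Longrightarrow> admissible G (Gs t) a"
  shows "requires_nSSP G"
  unfolding requires_nSSP_def nSSP_def
proof (intro ballI allI impI, elim conjE)
  fix A X :: "real^'n^'n"
  assume A: "A \<in> matrices_of G"
    and AX: "entrywise_prod A X = 0"
    and comm: "A ** transpose X - transpose X ** A = 0"
  \<comment> \<open>Zeros of \<open>X\<close> spread along the chain until, at \<open>t = k\<close>,
    they fill the matrix.\<close>
  have "X $ u $ v = 0" if "t \<le> k" "(u, v) \<in> Gs t" for t u v
    using that
  proof (induction t arbitrary: u v)
    case 0
    have "A $ u $ v * X $ u $ v = 0"
      using AX by (simp add: entrywise_prod_def vec_eq_iff)
    moreover have "A $ u $ v \<noteq> 0"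
      using A 0 assms(1) by (simp add: matrices_of_def)
    ultimately show ?case
      by simp
  next
    case (Suc t)
    show ?case
    proof (cases "(u, v) \<in> Gs t")
      case True
      then show ?thesis
        using Suc by simp
    next
      case False
      \<comment> \<open>All arcs new in \<open>Gs (Suc t)\<close> are admissible for the same
        \<open>Gs t\<close>, so each is handled independently of the others.\<close>
      then have "admissible G (Gs t) (u, v)"
        using Suc.prems assms(4) by simp
      then show ?thesis
        using admissible_entry_eq_0[OF A comm, of "Gs t" "(u, v)"] Suc by simp
    qed
  qed
  from this[of k] show "X = 0"
    using assms(2) by (simp add: vec_eq_iff complete_digraph_def)
qed

end
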